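(* Fix $\alpha\in(0,1)$. Assume that the residuals $\widehat{s}_t=y_t-\widehat{\mu}(x_t)$, for $t\in\mathcal{D}_{\mathrm{calib}}\cup\{T+1\}$, are i.i.d., and that the residuals $\widehat{s}_t$, for $t\in\mathcal{D}_{\mathrm{calib}}$, follow some elliptical distribution over $\mathbb{R}^m$ and have a finite second-order moment, with positive definite covariance matrix $\Sigma$. Let $\widetilde{C}^\star_1(x_{T+1}),\ldots,\widetilde{C}^\star_m(x_{T+1})$ be the prediction intervals output by the hierarchical component-wise split conformal procedure (see context) run with the matrix $$P_{\Sigma^{-1}}:=H\bigl(H^\top\Sigma^{-1}H\bigr)^{-1}H^\top\Sigma^{-1},$$ and let $\widehat{C}_1(x_{T+1}),\ldots,\widehat{C}_m(x_{T+1})$ be those output by the plain component-wise procedure, i.e., the same procedure run with $P=\mathrm{Id}_m$. Then $$\forall i\in\{1,\ldots,m\},\qquad \mathbb{E}\Bigl[\mathfrak{L}_1\bigl(\widetilde{C}^\star_i(x_{T+1})\bigr)^2\Bigr]\ \leq\ \mathbb{E}\Bigl[\mathfrak{L}_1\bigl(\widehat{C}_i(x_{T+1})\bigr)^2\Bigr].$$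
   Context: Hierarchical data: let $m\geq 3$, $2\leq n<m$, $d\geq 1$, and let $H=\begin{bmatrix}\mathrm{Id}_n\\ H_{\mathrm{sub}}\end{bmatrix}$ be a fixed $m\times n$ real matrix, where $H_{\mathrm{sub}}$ is any $(m-n)\times n$ real matrix. The data are random pairs $(x_t,y_t)$, $1\leq t\leq T+1$, with $x_t\in\mathbb{R}^d$ and $y_t\in\mathbb{R}^m$, where all observations are coherent: $y_t=H\,(y_{t,1},\ldots,y_{t,n})^\top$, i.e., $y_t\in\mathrm{Im}(H)$. Expectations are with respect to all the data and may be infinite. $\mathfrak{L}_1$ denotes the Lebesgue measure on $\mathbb{R}$ (an unbounded interval has measure $+\infty$). Elliptical distributions: a random vector $z$ follows a spherical distribution over $\mathbb{R}^k$ if $z$ and $\Gamma z$ have the same distribution for all $k\times k$ orthogonal matrices $\Gamma$. An elliptical distribution over $\mathbb{R}^m$ is the distribution of a vector $c+Mz$, for a deterministic $c\in\mathbb{R}^m$, an $m\times k$ matrix $M$ such that $MM^\top$ has rank $k$, and a random vector $z$ following a spherical distribution over $\mathbb{R}^k$. Procedure run with a fixed $m\times m$ matrix $P$: the set of indices $\mathcal{D}_{\mathrm{train}}\cup\mathcal{D}_{\mathrm{calib}}=\{1,\ldots,T\}$ is a (deterministic) partition; let $T_{\mathrm{calib}}$ be the cardinality of $\mathcal{D}_{\mathrm{calib}}$. (1) A regression algorithm $\mathcal{A}$ (an arbitrary black box) outputs a function $\widehat{\mu}:\mathbb{R}^d\to\mathbb{R}^m$ based on $(x_t,y_t)_{t\in\mathcal{D}_{\mathrm{train}}}$.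 Set $\widetilde{\mu}(\cdot)=P\widehat{\mu}(\cdot)$, with components $\widetilde{\mu}_i$. (2) For $t\in\mathcal{D}_{\mathrm{calib}}$, let $\widetilde{s}_t=y_t-\widetilde{\mu}(x_t)$, with components $\widetilde{s}_{t,i}$. (3) For each $i\in\{1,\ldots,m\}$, order $(\widetilde{s}_{t,i})_{t\in\mathcal{D}_{\mathrm{calib}}}$ into $\widetilde{s}_{(1),i}\leq\cdots\leq\widetilde{s}_{(T_{\mathrm{calib}}),i}$ and set $\widetilde{s}_{(0),i}=-\infty$, $\widetilde{s}_{(T_{\mathrm{calib}}+1),i}=+\infty$. (4) Output the prediction intervals $$\widetilde{C}_i(x_{T+1})=\Bigl[\widetilde{\mu}_i(x_{T+1})+\widetilde{s}_{(\lfloor (T_{\mathrm{calib}}+1)\alpha/2\rfloor),i}\,,\ \widetilde{\mu}_i(x_{T+1})+\widetilde{s}_{(\lceil (T_{\mathrm{calib}}+1)(1-\alpha/2)\rceil),i}\Bigr].$$ The two runs compared use the same $\alpha$, the same partition and the same algorithm $\mathcal{A}$ (hence the same $\widehat{\mu}$). *)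

theory Defs
  imports "HOL-Probability.Probability"
begin

text \<open>The coordinates of the observations are indexed by the sum type \<open>'n + 'k\<close>, where
  \<open>n = CARD('n)\<close> and \<open>m - n = CARD('k)\<close>: the \<open>Inl\<close> coordinates are the first \<open>n\<close> ones.
  As \<open>'k\<close> is nonempty, \<open>n < m\<close> always holds.\<close>

definition hier_matrix :: "real^'n^'k \<Rightarrow> real^'n^('n + 'k)" where
  "hier_matrix Hsub = (\<chi> r. case r of Inl i \<Rightarrow> (mat 1 :: real^'n^'n) $ i | Inr l \<Rightarrow> Hsub $ l)"

definition coherent :: "real^'n^('n + 'k::finite) \<Rightarrow> real^('n + 'k) \<Rightarrow> bool" where
  "coherent H v \<longleftrightarrow> v = H *v (\<chi> j. v $ Inl j)"

definition weighted_proj :: "real^'n^'m \<Rightarrow> real^'m^'m \<Rightarrow> real^'m^'m" where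
  "weighted_proj H W = H ** matrix_inv (transpose H ** W ** H) ** transpose H ** W"

text \<open>The dimension \<open>k\<close> of the spherical vector is existentially quantified in the definition
  of an elliptical distribution, so it cannot be a type: \<open>\<real>\<^sup>k\<close> is represented here by the product
  space of \<open>k\<close> copies of \<open>borel\<close>, and matrices with a side of length \<open>k\<close> are indexed on that
  side by natural numbers below \<open>k\<close>.\<close>

definition orthogonal_mat_nat :: "nat \<Rightarrow> (nat \<Rightarrow> nat \<Rightarrow> real) \<Rightarrow> bool" where
  "orthogonal_mat_nat k \<Gamma> \<longleftrightarrow>
     (\<forall>i<k. \<forall>j<k. (\<Sum>l<k. \<Gamma> l i * \<Gamma> l j) = (if i = j then 1 else 0)) \<and>
     (\<forall>i<k. \<forall>j<k. (\<Sum>l<k. \<Gamma> i l * \<Gamma> j l) = (if i = j then 1 else 0))"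

definition spherical_distribution :: "nat \<Rightarrow> (nat \<Rightarrow> real) measure \<Rightarrow> bool" where
  "spherical_distribution k \<nu> \<longleftrightarrow>
     prob_space \<nu> \<and> sets \<nu> = sets (\<Pi>\<^sub>M i\<in>{..<k}. (borel :: real measure)) \<and>
     (\<forall>\<Gamma>. orthogonal_mat_nat k \<Gamma> \<longrightarrow>
        distr \<nu> (\<Pi>\<^sub>M i\<in>{..<k}. borel) (\<lambda>z. \<lambda>i\<in>{..<k}. \<Sum>j<k. \<Gamma> i j * z j) = \<nu>)"

definition elliptical_distribution :: "(real^'m) measure \<Rightarrow> bool" where
  "elliptical_distribution \<mu> \<longleftrightarrow>
     (\<exists>k \<nu> (c :: real^'m) (B :: 'm \<Rightarrow> nat \<Rightarrow> real).
        spherical_distribution k \<nu> \<and>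
        rank ((\<chi> i j. \<Sum>l<k. B i l * B j l) :: real^'m^'m) = k \<and>
        \<mu> = distr \<nu> borel (\<lambda>z. c + (\<chi> i. \<Sum>l<k. B i l * z l)))"

definition iid_vars :: "'w measure \<Rightarrow> (nat \<Rightarrow> 'w \<Rightarrow> real^'m) \<Rightarrow> nat set \<Rightarrow> bool" where
  "iid_vars M S I \<longleftrightarrow>
     prob_space.indep_vars M (\<lambda>_. borel) S I \<and>
     (\<forall>t\<in>I. \<forall>u\<in>I. distr M borel (S t) = distr M borel (S u))"

definition finite_second_moment :: "'w measure \<Rightarrow> ('w \<Rightarrow> real^'m) \<Rightarrow> bool" where
  "finite_second_moment M X \<longleftrightarrow> integrable M (\<lambda>\<omega>. (norm (X \<omega>))\<^sup>2)"

definition covariance_matrix :: "'w measure \<Rightarrow> ('w \<Rightarrow> real^'m) \<Rightarrow> real^'m^'m" where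
  "covariance_matrix M X =
     (\<chi> i j. \<integral>\<omega>. (X \<omega> $ i - (\<integral>\<omega>'. X \<omega>' $ i \<partial>M)) * (X \<omega> $ j - (\<integral>\<omega>'. X \<omega>' $ j \<partial>M)) \<partial>M)"

definition positive_definite :: "real^'m^'m \<Rightarrow> bool" where
  "positive_definite A \<longleftrightarrow> transpose A = A \<and> (\<forall>v. v \<noteq> 0 \<longrightarrow> v \<bullet> (A *v v) > 0)"

text \<open>An algorithm maps the training sample, a family that is \<open>undefined\<close> outside of the set of
  training indices, to a regression function.\<close>

type_synonym ('d, 'm) algorithm = "(nat \<Rightarrow> (real^'d) \<times> (real^'m)) \<Rightarrow> real^'d \<Rightarrow> real^'m"

definition mu_hat ::
  "('d, 'm) algorithm \<Rightarrow> nat set \<Rightarrow> (nat \<Rightarrow> real^'d) \<Rightarrow> (nat \<Rightarrow> real^'m) \<Rightarrow> real^'d \<Rightarrow> real^'m" where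
  "mu_hat \<A> Dtrain xs ys = \<A> (restrict (\<lambda>t. (xs t, ys t)) Dtrain)"

definition mu_tilde ::
  "('d, 'm) algorithm \<Rightarrow> real^'m^'m \<Rightarrow> nat set \<Rightarrow> (nat \<Rightarrow> real^'d) \<Rightarrow> (nat \<Rightarrow> real^'m)
     \<Rightarrow> real^'d \<Rightarrow> real^'m" where
  "mu_tilde \<A> P Dtrain xs ys x = P *v mu_hat \<A> Dtrain xs ys x"

definition order_stat :: "nat set \<Rightarrow> (nat \<Rightarrow> real) \<Rightarrow> nat \<Rightarrow> ereal" where
  "order_stat D s r =
     (if r = 0 then - \<infinity>
      else if r > card D then \<infinity>
      else ereal (sort (map s (sorted_list_of_set D)) ! (r - 1)))"

definition conformal_interval ::
  "('d, 'm) algorithm \<Rightarrow> real^'m^'m \<Rightarrow> real \<Rightarrow> nat set \<Rightarrow> nat set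
     \<Rightarrow> (nat \<Rightarrow> real^'d) \<Rightarrow> (nat \<Rightarrow> real^'m) \<Rightarrow> 'm \<Rightarrow> real^'d \<Rightarrow> real set" where
  "conformal_interval \<A> P \<alpha> Dtrain Dcalib xs ys i x =
     (let \<mu> = mu_tilde \<A> P Dtrain xs ys;
          s = (\<lambda>t. (ys t - \<mu> (xs t)) $ i);
          N = card Dcalib;
          lo = nat \<lfloor>(real N + 1) * \<alpha> / 2\<rfloor>;
          hi = nat \<lceil>(real N + 1) * (1 - \<alpha> / 2)\<rceil>
      in {v. ereal (\<mu> x $ i) + order_stat Dcalib s lo \<le> ereal v \<and>
             ereal v \<le> ereal (\<mu> x $ i) + order_stat Dcalib s hi})"

end

theory Submission
  imports Defs
begin

text \<open>On coherent data the residuals of the projected procedure are \<open>P s\<^sub>t\<close>, so coordinate \<open>i\<close> of both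
  procedures sees a linear form of the residuals \<open>s\<^sub>t\<close>. Reflections show that any two linear forms of
  an elliptical vector have the same law up to an affine change of variable, whose slope is the ratio
  of the standard deviations. An interval length is a difference of two order statistics, so it is
  translation invariant and scales with the slope; by independence its second moment is
  proportional to the variance of the linear form. Finally, \<open>P \<Sigma> P\<^sup>T = P \<Sigma>\<close> makes \<open>\<Sigma> - P \<Sigma> P\<^sup>T\<close>
  positive semidefinite. When the lower rank is \<open>0\<close>, both intervals are the whole line.\<close>

section \<open>Linear forms of spherical and elliptical vectors\<close>

text \<open>This is the reflection in the hyperplane orthogonal to \<open>w\<close>. It is
  symmetric, so the relations between its columns also give those between its rows.\<close>

lemma householder_orthogonal:
  fixes w :: "nat \<Rightarrow> real"
  shows "orthogonal_mat_nat k
    (\<lambda>i j. (if i = j then 1 else 0) - 2 * w i * w j / (\<Sum>l<k. (w l)\<^sup>2))"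
    (is "orthogonal_mat_nat k ?G")
proof -
  define W where "W = (\<Sum>l<k. (w l)\<^sup>2)"
  have entry: "(\<Sum>l<k. ?G l i * ?G l j) = (if i = j then 1 else 0)" if "i < k" "j < k" for i j
  proof (cases "W = 0")
    \<comment> \<open>Division by zero gives zero, so the matrix is the identity.\<close>
    case True
    then show ?thesis
      using that by (simp add: W_def if_distrib[where f="\<lambda>x. x * _"] cong: if_cong)
  next
    case False
    \<comment> \<open>Product of the two rank-one corrections without its factor
      \<open>(w l)\<^sup>2\<close>; summed over \<open>l\<close> it gives \<open>c * W\<close>,
      which cancels \<open>4 * w i * w j / W\<close>.\<close>
    define c where "c = 4 * w i * w j / W\<^sup>2"
    have "(\<Sum>l<k. ?G l i * ?G l j) =
        (\<Sum>l<k. (if l = i then if i = j then 1 else 0 else 0)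
          - (if l = i then 2 * w i * w j / W else 0) - (if l = j then 2 * w j * w i / W else 0)
          + c * (w l)\<^sup>2)"
      unfolding W_def[symmetric]
      by (intro sum.cong) (auto simp: c_def algebra_simps power2_eq_square)
    also have "\<dots> = (if i = j then 1 else 0) - 4 * w i * w j / W + c * W"
      using that by (simp add: sum.distrib sum_subtractf sum_distrib_left[symmetric] W_def[symmetric])
    finally show ?thesis
      using False by (simp add: c_def power2_eq_square)
  qed
  define G where "G = ?G"
  have sym: "G i l = G l i" for i l
    by (simp add: G_def mult.commute mult.left_commute)
  have cols: "(\<Sum>l<k. G l i * G l j) = (if i = j then 1 else 0)" if "i < k" "j < k" for i j
    using entry[OF that] by (simp only: G_def)
  have "(\<Sum>l<k. G i l * G j l) = (if i = j then 1 else 0)" if "i < k" "j < k" for i j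
    using cols[OF that] by (simp only: sym[of i] sym[of j])
  with cols have "orthogonal_mat_nat k G"
    by (simp add: orthogonal_mat_nat_def)
  then show ?thesis
    by (simp only: G_def)
qed

text \<open>The vector \<open>a\<close> and \<open>r\<close> times the vector \<open>b\<close> have
  the same norm, so the reflection along their difference \<open>w\<close> exchanges them.
  Invariance of \<open>\<nu>\<close> under it turns one form into the other.\<close>

lemma spherical_linear_form_distr:
  fixes a b :: "nat \<Rightarrow> real"
  assumes sph: "spherical_distribution k \<nu>"
    and norm: "(\<Sum>l<k. (a l)\<^sup>2) = r\<^sup>2 * (\<Sum>l<k. (b l)\<^sup>2)"
  shows "distr \<nu> borel (\<lambda>z. \<Sum>l<k. a l * z l) = distr \<nu> borel (\<lambda>z. r * (\<Sum>l<k. b l * z l))"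
proof -
  define w where "w l = a l - r * b l" for l
  define W where "W = (\<Sum>l<k. (w l)\<^sup>2)"
  define G where "G i j = (if i = j then 1 else 0) - 2 * w i * w j / W" for i j
  have [measurable_cong]: "sets \<nu> = sets (\<Pi>\<^sub>M i\<in>{..<k}. (borel :: real measure))"
    using sph by (simp add: spherical_distribution_def)
  have inv: "distr \<nu> (\<Pi>\<^sub>M i\<in>{..<k}. borel) (\<lambda>z. \<lambda>i\<in>{..<k}. \<Sum>j<k. G i j * z j) = \<nu>"
    using sph householder_orthogonal[of k w]
    by (simp add: spherical_distribution_def G_def[abs_def] W_def)
  \<comment> \<open>The equal norms enter here: they make the reflection move \<open>a\<close> by
    exactly \<open>w\<close>, so that it lands on \<open>r\<close> times \<open>b\<close>.\<close>
  have aw: "2 * (\<Sum>l<k. a l * w l) = W"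
  proof -
    have "W = (\<Sum>l<k. (a l)\<^sup>2) - 2 * r * (\<Sum>l<k. a l * b l) + r\<^sup>2 * (\<Sum>l<k. (b l)\<^sup>2)"
      by (simp add: W_def w_def power2_diff sum.distrib sum_subtractf sum_distrib_left
          algebra_simps)
    moreover have "(\<Sum>l<k. a l * w l) = (\<Sum>l<k. (a l)\<^sup>2) - r * (\<Sum>l<k. a l * b l)"
      by (simp add: w_def sum_subtractf sum_distrib_left algebra_simps power2_eq_square)
    ultimately show ?thesis
      using norm by simp
  qed
  have image: "(\<Sum>i<k. a i * G i j) = r * b j" if "j < k" for j
  proof -
    have "(\<Sum>i<k. a i * G i j) = (\<Sum>i<k. (if i = j then a j else 0) - 2 * w j / W * (a i * w i))"
      by (intro sum.cong) (auto simp: G_def algebra_simps)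
    also have "\<dots> = a j - w j / W * (2 * (\<Sum>i<k. a i * w i))"
      using that by (simp add: sum_subtractf sum_distrib_left algebra_simps)
    also have "\<dots> = r * b j"
    proof (cases "W = 0")
      \<comment> \<open>Here \<open>w\<close> vanishes below \<open>k\<close>, so the two
        coefficient vectors already agree there.\<close>
      case True
      then have "w j = 0"
        using that by (auto simp: W_def sum_nonneg_eq_0_iff)
      then show ?thesis by (simp add: w_def)
    next
      case False
      then show ?thesis by (simp only: aw) (simp add: w_def)
    qed
    finally show ?thesis .
  qed
  have "distr \<nu> borel (\<lambda>z. \<Sum>l<k. a l * z l) =
      distr (distr \<nu> (\<Pi>\<^sub>M i\<in>{..<k}. borel) (\<lambda>z. \<lambda>i\<in>{..<k}. \<Sum>j<k. G i j * z j)) borel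
        (\<lambda>z. \<Sum>l<k. a l * z l)"
    by (simp add: inv)
  also have "\<dots> = distr \<nu> borel (\<lambda>z. \<Sum>i<k. a i * (\<Sum>j<k. G i j * z j))"
    by (subst distr_distr) (auto intro!: arg_cong[where f="distr \<nu> borel"] simp: comp_def)
  also have "(\<lambda>z. \<Sum>i<k. a i * (\<Sum>j<k. G i j * z j)) = (\<lambda>z. \<Sum>j<k. (\<Sum>i<k. a i * G i j) * z j)"
    unfolding sum_distrib_left sum_distrib_right mult.assoc
    by (intro ext sum.swap)
  also have "\<dots> = (\<lambda>z. r * (\<Sum>l<k. b l * z l))"
    by (simp add: image sum_distrib_left mult.assoc)
  finally show ?thesis .
qed

text \<open>A linear form \<open>u\<close> of the elliptical vector is a constant plus the form with
  coefficients \<open>row u\<close> of the underlying spherical vector, which reduces the claim to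
  the spherical case. Nondegeneracy of \<open>q\<close> makes \<open>row q\<close> nonzero.\<close>

lemma elliptical_linear_form_distr:
  fixes p q :: "real^'m"
  assumes ell: "elliptical_distribution \<mu>"
    and nondegenerate: "\<And>c. \<not> (AE v in \<mu>. q \<bullet> v = c)"
  obtains m r where "0 \<le> r"
    "distr \<mu> borel (\<lambda>v. p \<bullet> v) = distr \<mu> borel (\<lambda>v. m + r * (q \<bullet> v))"
proof -
  obtain k \<nu> and c :: "real^'m" and B :: "'m \<Rightarrow> nat \<Rightarrow> real" where
    sph: "spherical_distribution k \<nu>" and
    \<mu>: "\<mu> = distr \<nu> borel (\<lambda>z. c + (\<chi> i. \<Sum>l<k. B i l * z l))"
    using ell unfolding elliptical_distribution_def by blast
  have [measurable_cong]: "sets \<nu> = sets (\<Pi>\<^sub>M i\<in>{..<k}. (borel :: real measure))"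
    using sph by (simp add: spherical_distribution_def)
  define X where "X z = c + (\<chi> i. \<Sum>l<k. B i l * z l)" for z
  have X[measurable]: "X \<in> borel_measurable \<nu>"
    unfolding borel_measurable_euclidean_space[of X]
    by (auto simp: X_def Basis_vec_def inner_axis)
  have \<mu>X: "\<mu> = distr \<nu> borel X"
    by (simp add: \<mu> X_def[abs_def])
  define row where "row u l = (\<Sum>i\<in>UNIV. u $ i * B i l)" for u :: "real^'m" and l
  have lin: "u \<bullet> X z = u \<bullet> c + (\<Sum>l<k. row u l * z l)" for u z
  proof -
    have "(\<Sum>i\<in>UNIV. u $ i * (\<Sum>l<k. B i l * z l)) = (\<Sum>i\<in>UNIV. \<Sum>l<k. u $ i * B i l * z l)"
      by (simp add: sum_distrib_left mult.assoc)
    also have "\<dots> = (\<Sum>l<k. row u l * z l)"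
      by (subst sum.swap) (simp add: row_def sum_distrib_right)
    finally show ?thesis
      by (simp add: X_def inner_vec_def distrib_left sum.distrib)
  qed
  \<comment> \<open>Ratio of the norms of the coefficient vectors. The nonnegative root makes the
    change of variable monotone, so that it commutes with sorting later.\<close>
  define r where "r = sqrt ((\<Sum>l<k. (row p l)\<^sup>2) / (\<Sum>l<k. (row q l)\<^sup>2))"
  have "(\<Sum>l<k. (row q l)\<^sup>2) \<noteq> 0"
  proof
    assume "(\<Sum>l<k. (row q l)\<^sup>2) = 0"
    then have "\<forall>l<k. row q l = 0"
      by (auto simp: sum_nonneg_eq_0_iff)
    then have "q \<bullet> X z = q \<bullet> c" for z
      by (simp add: lin)
    then have "AE v in \<mu>. q \<bullet> v = q \<bullet> c"
      unfolding \<mu>X by (subst AE_distr_iff) auto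
    with nondegenerate show False by blast
  qed
  then have "(\<Sum>l<k. (row p l)\<^sup>2) = r\<^sup>2 * (\<Sum>l<k. (row q l)\<^sup>2)"
    by (simp add: r_def real_sqrt_pow2 sum_nonneg)
  from spherical_linear_form_distr[OF sph this]
  have eq: "distr \<nu> borel (\<lambda>z. \<Sum>l<k. row p l * z l) =
      distr \<nu> borel (\<lambda>z. r * (\<Sum>l<k. row q l * z l))" .
  show thesis
  proof
    show "0 \<le> r" by (simp add: r_def sum_nonneg)
    have "distr \<mu> borel (\<lambda>v. p \<bullet> v) = distr \<nu> borel (\<lambda>z. p \<bullet> c + (\<Sum>l<k. row p l * z l))"
      unfolding \<mu>X by (subst distr_distr) (simp_all add: comp_def lin)
    also have "\<dots> = distr (distr \<nu> borel (\<lambda>z. \<Sum>l<k. row p l * z l)) borel (\<lambda>x. p \<bullet> c + x)"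
      by (subst distr_distr) (simp_all add: comp_def)
    also have "\<dots> = distr \<nu> borel (\<lambda>z. p \<bullet> c + r * (\<Sum>l<k. row q l * z l))"
      unfolding eq by (subst distr_distr) (simp_all add: comp_def)
    \<comment> \<open>The witness for \<open>m\<close> trades the centre of the \<open>q\<close>
      form for that of the \<open>p\<close> form.\<close>
    also have "\<dots> = distr \<mu> borel (\<lambda>v. (p \<bullet> c - r * (q \<bullet> c)) + r * (q \<bullet> v))"
      unfolding \<mu>X by (subst distr_distr) (simp_all add: comp_def lin algebra_simps)
    finally show "distr \<mu> borel (\<lambda>v. p \<bullet> v) =
      distr \<mu> borel (\<lambda>v. (p \<bullet> c - r * (q \<bullet> c)) + r * (q \<bullet> v))" .
  qed
qed

section \<open>Order statistics as functions of the sample\<close>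

text \<open>In a sorted list the entries at most \<open>a\<close> form an initial segment, so their
  number decides which positions are at most \<open>a\<close>.\<close>

lemma sorted_nth_le_iff:
  fixes xs :: "'a::linorder list"
  assumes "sorted xs" "j < length xs"
  shows "xs ! j \<le> a \<longleftrightarrow> j < length (filter (\<lambda>x. x \<le> a) xs)"
  using assms
proof (induction xs arbitrary: j)
  case (Cons x xs)
  show ?case
  proof (cases "x \<le> a")
    case True
    then show ?thesis using Cons by (cases j) auto
  next
    case False
    then have "\<forall>y\<in>set (x # xs). \<not> y \<le> a"
      using Cons.prems(1) by auto
    then show ?thesis
      using Cons.prems(2) nth_mem[OF Cons.prems(2)] by (metis filter_False less_zeroE list.size(3))
  qed
qed simp

lemma sort_map_mono:
  fixes f :: "'a::linorder \<Rightarrow> 'b::linorder"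
  assumes "mono f"
  shows "sort (map f xs) = map f (sort xs)"
proof (rule properties_for_sort)
  show "mset (map f (sort xs)) = mset (map f xs)" by simp
  show "sorted (map f (sort xs))"
    by (simp add: sorted_map) (rule sorted_wrt_mono_rel[OF _ sorted_sort], simp add: monoD[OF assms])
qed

text \<open>A sublevel set of an order statistic says that more than \<open>j\<close> sample values
  are at most the threshold. Their number is a finite sum of indicators, hence measurable.\<close>

lemma order_stat_measurable:
  fixes D :: "'t::linorder set"
  assumes "finite D" "j < card D"
  shows "(\<lambda>s. sort (map s (sorted_list_of_set D)) ! j) \<in> borel_measurable (\<Pi>\<^sub>M t\<in>D. (borel :: real measure))"
proof (rule borel_measurableI_le)
  fix a :: real
  have "sort (map s (sorted_list_of_set D)) ! j \<le> a \<longleftrightarrow> j < card {t \<in> D. s t \<le> a}"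
    for s :: "'t \<Rightarrow> real"
  proof -
    have "mset (filter (\<lambda>x. x \<le> a) (sort (map s (sorted_list_of_set D)))) =
        mset (filter (\<lambda>x. x \<le> a) (map s (sorted_list_of_set D)))"
      by simp
    then have "length (filter (\<lambda>x. x \<le> a) (sort (map s (sorted_list_of_set D)))) =
        length (filter (\<lambda>x. x \<le> a) (map s (sorted_list_of_set D)))"
      by (metis size_mset)
    also have "\<dots> = card (set (filter (\<lambda>t. s t \<le> a) (sorted_list_of_set D)))"
      by (subst distinct_card) (simp_all add: filter_map comp_def)
    also have "\<dots> = card {t \<in> D. s t \<le> a}"
      using assms by (auto intro!: arg_cong[where f=card])
    finally show ?thesis
      using assms by (simp add: sorted_nth_le_iff)
  qed
  moreover have "card {t \<in> D. s t \<le> a} = (\<Sum>t\<in>D. if s t \<le> a then 1 else 0)" for s :: "'t \<Rightarrow> real"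
    using assms(1) by (simp add: sum.If_cases Int_def)
  ultimately have eq: "{s \<in> space (\<Pi>\<^sub>M t\<in>D. borel). sort (map s (sorted_list_of_set D)) ! j \<le> a} =
      {s \<in> space (\<Pi>\<^sub>M t\<in>D. (borel :: real measure)). j < (\<Sum>t\<in>D. if s t \<le> a then 1 else 0 :: nat)}"
    by simp
  show "{s \<in> space (\<Pi>\<^sub>M t\<in>D. borel). sort (map s (sorted_list_of_set D)) ! j \<le> a}
      \<in> sets (\<Pi>\<^sub>M t\<in>D. (borel :: real measure))"
    unfolding eq by measurable
qed

section \<open>Second moments and transfer along equal laws\<close>

lemma (in prob_space) finite_second_moment_integrable:
  fixes X :: "'a \<Rightarrow> real^'m"
  assumes [measurable]: "X \<in> borel_measurable M" and fin: "finite_second_moment M X"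
  shows "integrable M (\<lambda>\<omega>. X \<omega> $ i * X \<omega> $ j)" and "integrable M (\<lambda>\<omega>. X \<omega> $ i)"
proof -
  have comp[measurable]: "(\<lambda>\<omega>. X \<omega> $ i) \<in> borel_measurable M" for i
    by (simp add: cart_eq_inner_axis)
  show prod: "integrable M (\<lambda>\<omega>. X \<omega> $ i * X \<omega> $ j)" for i j
  proof (rule Bochner_Integration.integrable_bound)
    show "integrable M (\<lambda>\<omega>. (norm (X \<omega>))\<^sup>2)"
      using fin by (simp add: finite_second_moment_def)
    show "AE \<omega> in M. norm (X \<omega> $ i * X \<omega> $ j) \<le> norm ((norm (X \<omega>))\<^sup>2)"
      by (auto simp: abs_mult power2_eq_square intro!: mult_mono component_le_norm_cart)
  qed measurable
  show "integrable M (\<lambda>\<omega>. X \<omega> $ i)"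
    by (rule square_integrable_imp_integrable) (use prod[of i i] in \<open>simp_all add: power2_eq_square\<close>)
qed

lemma (in prob_space) variance_linear_form:
  fixes X :: "'a \<Rightarrow> real^'m"
  assumes X: "X \<in> borel_measurable M" and fin: "finite_second_moment M X"
  shows "variance (\<lambda>\<omega>. p \<bullet> X \<omega>) = p \<bullet> (covariance_matrix M X *v p)"
proof -
  note int = finite_second_moment_integrable[OF assms]
  define m where "m i = expectation (\<lambda>\<omega>. X \<omega> $ i)" for i
  define Z where "Z \<omega> i j = (X \<omega> $ i - m i) * (X \<omega> $ j - m j)" for \<omega> i j
  have Z: "integrable M (\<lambda>\<omega>. Z \<omega> i j)" for i j
    using int by (auto simp: Z_def left_diff_distrib right_diff_distrib)
  have "expectation (\<lambda>\<omega>. p \<bullet> X \<omega>) = (\<Sum>i\<in>UNIV. p $ i * m i)"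
    using int by (simp add: inner_vec_def m_def)
  then have "variance (\<lambda>\<omega>. p \<bullet> X \<omega>) = expectation (\<lambda>\<omega>. (\<Sum>i\<in>UNIV. p $ i * (X \<omega> $ i - m i))\<^sup>2)"
    by (simp add: inner_vec_def right_diff_distrib sum_subtractf)
  also have "\<dots> = expectation (\<lambda>\<omega>. \<Sum>i\<in>UNIV. \<Sum>j\<in>UNIV. p $ i * p $ j * Z \<omega> i j)"
    by (simp add: power2_eq_square sum_product Z_def mult_ac)
  also have "\<dots> = (\<Sum>i\<in>UNIV. \<Sum>j\<in>UNIV. p $ i * p $ j * expectation (\<lambda>\<omega>. Z \<omega> i j))"
    using Z by simp
  also have "\<dots> = p \<bullet> (covariance_matrix M X *v p)"
    by (simp add: inner_vec_def matrix_vector_mult_def covariance_matrix_def Z_def m_def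
        sum_distrib_left mult_ac)
  finally show ?thesis .
qed

text \<open>Means and variances depend only on the law. This ties the slope \<open>r\<close> found
  for elliptical laws to the ratio of the variances.\<close>

lemma (in prob_space) variance_affine_of_distr_eq:
  fixes Y Z :: "'a \<Rightarrow> real"
  assumes [measurable]: "Y \<in> borel_measurable M" "Z \<in> borel_measurable M"
    and int: "integrable M Z"
    and distr: "distr M borel Y = distr M borel (\<lambda>\<omega>. m + r * Z \<omega>)"
  shows "variance Y = r\<^sup>2 * variance Z"
proof -
  have transfer: "expectation (\<lambda>\<omega>. f (Y \<omega>)) = expectation (\<lambda>\<omega>. f (m + r * Z \<omega>))"
    if [measurable]: "f \<in> borel_measurable borel" for f :: "real \<Rightarrow> real"
  proof -
    have "expectation (\<lambda>\<omega>. f (Y \<omega>)) = integral\<^sup>L (distr M borel Y) f"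
      by (simp add: integral_distr)
    also have "\<dots> = expectation (\<lambda>\<omega>. f (m + r * Z \<omega>))"
      unfolding distr by (simp add: integral_distr)
    finally show ?thesis .
  qed
  have mean: "expectation Y = m + r * expectation Z"
    using transfer[of "\<lambda>x. x"] int by (simp add: prob_space)
  have "variance Y = expectation (\<lambda>\<omega>. r\<^sup>2 * (Z \<omega> - expectation Z)\<^sup>2)"
    unfolding mean by (subst transfer) (simp_all add: algebra_simps power2_eq_square)
  then show ?thesis by simp
qed

text \<open>Independence makes each joint law the product of its marginals, so equal marginals give
  equal joint laws. In the application both families are built from the same residuals.\<close>

lemma (in prob_space) nn_integral_indep_vars_cong_distr:
  fixes Y Z :: "'i \<Rightarrow> 'a \<Rightarrow> 'b::topological_space"
  assumes Y: "indep_vars (\<lambda>_. borel) Y D" and Z: "indep_vars (\<lambda>_. borel) Z D"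
    and law: "\<And>t. t \<in> D \<Longrightarrow> distr M borel (Y t) = distr M borel (Z t)"
    and f: "f \<in> borel_measurable (\<Pi>\<^sub>M t\<in>D. borel)"
  shows "(\<integral>\<^sup>+\<omega>. f (\<lambda>t\<in>D. Y t \<omega>) \<partial>M) = (\<integral>\<^sup>+\<omega>. f (\<lambda>t\<in>D. Z t \<omega>) \<partial>M)"
proof (cases "D = {}")
  \<comment> \<open>Over an empty index set both restrictions are the same function; the product
    description of the joint law is used for nonempty \<open>D\<close>.\<close>
  case True
  then show ?thesis by (simp add: restrict_def)
next
  case False
  have [measurable]: "Y t \<in> borel_measurable M" "Z t \<in> borel_measurable M" if "t \<in> D" for t
    using that Y Z by (auto simp: indep_vars_def)
  have "distr M (\<Pi>\<^sub>M t\<in>D. borel) (\<lambda>\<omega>. \<lambda>t\<in>D. Y t \<omega>) = (\<Pi>\<^sub>M t\<in>D. distr M borel (Y t))"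
    using Y False by (subst indep_vars_iff_distr_eq_PiM'[symmetric]) auto
  also have "\<dots> = (\<Pi>\<^sub>M t\<in>D. distr M borel (Z t))"
    by (intro PiM_cong) (auto simp: law)
  also have "\<dots> = distr M (\<Pi>\<^sub>M t\<in>D. borel) (\<lambda>\<omega>. \<lambda>t\<in>D. Z t \<omega>)"
    using Z False by (subst (asm) indep_vars_iff_distr_eq_PiM') auto
  finally have joint: "distr M (\<Pi>\<^sub>M t\<in>D. borel) (\<lambda>\<omega>. \<lambda>t\<in>D. Y t \<omega>) =
    distr M (\<Pi>\<^sub>M t\<in>D. borel) (\<lambda>\<omega>. \<lambda>t\<in>D. Z t \<omega>)" .
  have "(\<integral>\<^sup>+\<omega>. f (\<lambda>t\<in>D. Y t \<omega>) \<partial>M) = (\<integral>\<^sup>+z. f z \<partial>distr M (\<Pi>\<^sub>M t\<in>D. borel) (\<lambda>\<omega>. \<lambda>t\<in>D. Y t \<omega>))"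
    by (subst nn_integral_distr) (auto simp: f)
  also have "\<dots> = (\<integral>\<^sup>+\<omega>. f (\<lambda>t\<in>D. Z t \<omega>) \<partial>M)"
    unfolding joint by (subst nn_integral_distr) (auto simp: f)
  finally show ?thesis .
qed

section \<open>Differences of order statistics of linear forms\<close>

text \<open>Slope \<open>0\<close> is allowed: the map is then constant, hence still
  monotone.\<close>

lemma sort_map_affine_nth:
  fixes s :: "'b \<Rightarrow> real"
  assumes "0 \<le> r" "j < length xs"
  shows "sort (map (\<lambda>t. m + r * s t) xs) ! j = m + r * sort (map s xs) ! j"
proof -
  have "mono (\<lambda>x. m + r * x)"
    using assms(1) by (intro monoI) (simp add: mult_left_mono)
  from sort_map_mono[OF this, of "map s xs"] show ?thesis
    using assms(2) by (simp add: comp_def)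
qed

text \<open>Length of a conformal interval with finite end points. Positions are counted from zero,
  the lower one \<open>j\<close> first.\<close>

definition spread :: "'t::linorder set \<Rightarrow> nat \<Rightarrow> nat \<Rightarrow> ('t \<Rightarrow> real) \<Rightarrow> real" where
  "spread D j k s = sort (map s (sorted_list_of_set D)) ! k - sort (map s (sorted_list_of_set D)) ! j"

lemma spread_cong:
  assumes "finite D" "\<And>t. t \<in> D \<Longrightarrow> s t = s' t"
  shows "spread D j k s = spread D j k s'"
proof -
  have "map s (sorted_list_of_set D) = map s' (sorted_list_of_set D)"
    using assms by simp
  then show ?thesis by (simp only: spread_def)
qed

lemma spread_nonneg:
  assumes "j \<le> k" "k < card D"
  shows "0 \<le> spread D j k s"
  using assms by (simp add: spread_def sorted_nth_mono)

lemma spread_affine: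
  assumes "0 \<le> r" "j < card D" "k < card D"
  shows "spread D j k (\<lambda>t. m + r * s t) = r * spread D j k s"
  using assms by (simp add: spread_def sort_map_affine_nth right_diff_distrib)

lemma spread_measurable:
  assumes "finite D" "j < card D" "k < card D"
  shows "spread D j k \<in> borel_measurable (\<Pi>\<^sub>M t\<in>D. (borel :: real measure))"
  unfolding spread_def[abs_def] using assms
  by (intro borel_measurable_diff order_stat_measurable)

text \<open>For every \<open>t\<close> the \<open>p\<close> form has the law of \<open>m\<close>
  plus \<open>r\<close> times the \<open>q\<close> form, with the same \<open>m\<close> and
  \<open>r\<close>, and independence extends this to the whole sample. The shift cancels in the
  spread, and the variance comparison bounds \<open>r\<close> by \<open>1\<close>.\<close>

lemma (in prob_space) elliptical_spread_le:
  fixes S :: "'t::linorder \<Rightarrow> 'a \<Rightarrow> real^'m"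
  assumes indep: "indep_vars (\<lambda>_. borel) S D"
    and law: "\<And>t u. t \<in> D \<Longrightarrow> u \<in> D \<Longrightarrow> distr M borel (S t) = distr M borel (S u)"
    and ell: "\<And>t. t \<in> D \<Longrightarrow> elliptical_distribution (distr M borel (S t))"
    and fin: "\<And>t. t \<in> D \<Longrightarrow> finite_second_moment M (S t)"
    and cov: "\<And>t. t \<in> D \<Longrightarrow> covariance_matrix M (S t) = \<Sigma>"
    and q: "0 < q \<bullet> (\<Sigma> *v q)" and pq: "p \<bullet> (\<Sigma> *v p) \<le> q \<bullet> (\<Sigma> *v q)"
    and D: "finite D" and jk: "j \<le> k" "k < card D"
  shows "(\<integral>\<^sup>+\<omega>. (ennreal (spread D j k (\<lambda>t. p \<bullet> S t \<omega>)))\<^sup>2 \<partial>M)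
    \<le> (\<integral>\<^sup>+\<omega>. (ennreal (spread D j k (\<lambda>t. q \<bullet> S t \<omega>)))\<^sup>2 \<partial>M)"
proof -
  have S[measurable]: "S t \<in> borel_measurable M" if "t \<in> D" for t
    using indep that by (simp add: indep_vars_def)
  \<comment> \<open>\<open>k < card D\<close> makes \<open>D\<close> nonempty; \<open>m\<close> and
    \<open>r\<close> are chosen from the law at this one index.\<close>
  obtain t0 where t0: "t0 \<in> D"
    using jk by (cases "D = {}") auto
  note [measurable] = S[OF t0]
  have var: "variance (\<lambda>\<omega>. u \<bullet> S t0 \<omega>) = u \<bullet> (\<Sigma> *v u)" for u
    using variance_linear_form[OF S[OF t0] fin[OF t0]] by (simp add: cov[OF t0])
  \<comment> \<open>An almost surely constant \<open>q\<close> form would have variance zero,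
    against the hypothesis on \<open>q\<close>.\<close>
  have nondegenerate: "\<not> (AE v in distr M borel (S t0). q \<bullet> v = c)" for c
  proof
    assume "AE v in distr M borel (S t0). q \<bullet> v = c"
    then have ae: "AE \<omega> in M. q \<bullet> S t0 \<omega> = c"
      by (subst (asm) AE_distr_iff) auto
    then have "expectation (\<lambda>\<omega>. q \<bullet> S t0 \<omega>) = expectation (\<lambda>_. c)"
      by (intro integral_cong_AE) auto
    then have mean: "expectation (\<lambda>\<omega>. q \<bullet> S t0 \<omega>) = c"
      by (simp add: prob_space)
    have "variance (\<lambda>\<omega>. q \<bullet> S t0 \<omega>) = expectation (\<lambda>_. 0)"
      unfolding mean using ae by (intro integral_cong_AE) auto
    with q var show False by simp
  qed
  obtain m r where r: "0 \<le> r" and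
    mr: "distr (distr M borel (S t0)) borel (\<lambda>v. p \<bullet> v) =
      distr (distr M borel (S t0)) borel (\<lambda>v. m + r * (q \<bullet> v))"
    using elliptical_linear_form_distr[OF ell[OF t0] nondegenerate] by blast
  have form_law: "distr M borel (\<lambda>\<omega>. p \<bullet> S t \<omega>) = distr M borel (\<lambda>\<omega>. m + r * (q \<bullet> S t \<omega>))"
    if t: "t \<in> D" for t
  proof -
    note [measurable] = S[OF t]
    show ?thesis
      using mr unfolding law[OF t0 t] by (simp add: distr_distr comp_def)
  qed
  have "integrable M (\<lambda>\<omega>. q \<bullet> S t0 \<omega>)"
    using finite_second_moment_integrable(2)[OF S[OF t0] fin[OF t0]] by (simp add: inner_vec_def)
  from variance_affine_of_distr_eq[OF _ _ this form_law[OF t0]]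
  have "p \<bullet> (\<Sigma> *v p) = r\<^sup>2 * (q \<bullet> (\<Sigma> *v q))"
    by (simp add: var)
  with pq q have "r\<^sup>2 \<le> 1"
    by (simp add: mult_le_cancel_right1)
  with r have r1: "r \<le> 1"
    by (simp add: abs_square_le_1)
  define f where "f s = (ennreal (spread D j k s))\<^sup>2" for s
  have f[measurable]: "f \<in> borel_measurable (\<Pi>\<^sub>M t\<in>D. borel)"
  proof -
    have [measurable]: "spread D j k \<in> borel_measurable (\<Pi>\<^sub>M t\<in>D. borel)"
      using jk by (intro spread_measurable D) auto
    show ?thesis unfolding f_def by measurable
  qed
  have f_restrict: "f (restrict s D) = f s" for s
    unfolding f_def using spread_cong[OF D, of "restrict s D" s] by simp
  have "(\<integral>\<^sup>+\<omega>. f (\<lambda>t\<in>D. p \<bullet> S t \<omega>) \<partial>M) = (\<integral>\<^sup>+\<omega>. f (\<lambda>t\<in>D. m + r * (q \<bullet> S t \<omega>)) \<partial>M)"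
    by (intro nn_integral_indep_vars_cong_distr form_law f indep_vars_compose2[OF indep]) auto
  \<comment> \<open>After the change of law the bound is pointwise: a factor \<open>r\<close>
    between \<open>0\<close> and \<open>1\<close> shrinks a nonnegative spread.\<close>
  also have "\<dots> \<le> (\<integral>\<^sup>+\<omega>. f (\<lambda>t. q \<bullet> S t \<omega>) \<partial>M)"
  proof (intro nn_integral_mono)
    fix \<omega>
    have "r * spread D j k (\<lambda>t. q \<bullet> S t \<omega>) \<le> spread D j k (\<lambda>t. q \<bullet> S t \<omega>)"
      using r1 spread_nonneg[OF jk] by (simp add: mult_left_le_one_le r)
    then show "f (\<lambda>t\<in>D. m + r * (q \<bullet> S t \<omega>)) \<le> f (\<lambda>t. q \<bullet> S t \<omega>)"
      unfolding f_restrict using jk r by (simp add: f_def spread_affine power_mono ennreal_leI)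
  qed
  finally show ?thesis
    by (simp add: f_restrict) (simp add: f_def)
qed

section \<open>Positive definite matrices and weighted projections\<close>

lemma matrix_inv_inverse:
  fixes A :: "'a::semiring_1^'n^'m"
  assumes "invertible A"
  shows "A ** matrix_inv A = mat 1" "matrix_inv A ** A = mat 1"
  using someI_ex[OF assms[unfolded invertible_def]] by (simp_all add: matrix_inv_def)

lemma inner_transpose_matrix:
  fixes A :: "real^'n^'m"
  shows "(transpose A *v v) \<bullet> w = v \<bullet> (A *v w)"
  by (simp add: dot_lmul_matrix)

lemma symmetric_matrix_inv:
  fixes A :: "'a::field^'n^'n"
  assumes "invertible A" "transpose A = A"
  shows "transpose (matrix_inv A) = matrix_inv A"
proof -
  have "transpose (matrix_inv A) ** A = mat 1"
    using matrix_inv_inverse(1)[OF assms(1)] by (metis assms(2) matrix_transpose_mul transpose_mat)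
  then show ?thesis
    using matrix_inv_inverse(1)[OF assms(1)]
    by (metis matrix_mul_assoc matrix_mul_lid matrix_mul_rid)
qed

lemma positive_definite_invertible:
  assumes "positive_definite A"
  shows "invertible A"
proof -
  have "inj ((*v) A)"
  proof (rule injI)
    fix u v assume "A *v u = A *v v"
    then have "(u - v) \<bullet> (A *v (u - v)) = 0"
      by (simp add: matrix_vector_mult_diff_distrib)
    with assms show "u = v"
      unfolding positive_definite_def by (metis eq_iff_diff_eq_0 less_irrefl)
  qed
  then show ?thesis
    by (simp add: invertible_left_inverse matrix_left_invertible_injective)
qed

lemma positive_definite_matrix_inv:
  assumes A: "positive_definite A"
  shows "positive_definite (matrix_inv A)"
  unfolding positive_definite_def
proof (intro conjI allI impI)
  note inv = positive_definite_invertible[OF A]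
  show "transpose (matrix_inv A) = matrix_inv A"
    using A inv by (simp add: symmetric_matrix_inv positive_definite_def)
  fix v :: "real^'a" assume "v \<noteq> 0"
  define u where "u = matrix_inv A *v v"
  have v: "v = A *v u"
    by (simp add: u_def matrix_vector_mul_assoc matrix_inv_inverse(1)[OF inv])
  with \<open>v \<noteq> 0\<close> have "u \<noteq> 0" by auto
  with A have "u \<bullet> (A *v u) > 0"
    by (simp add: positive_definite_def)
  then show "v \<bullet> (matrix_inv A *v v) > 0"
    by (simp add: u_def[symmetric]) (simp add: v inner_commute)
qed

text \<open>The quadratic form at \<open>v\<close> is that of \<open>A\<close> at
  \<open>H *v v\<close>, a nonzero vector by injectivity.\<close>

lemma positive_definite_congruence:
  fixes A :: "real^'m^'m" and H :: "real^'n^'m"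
  assumes A: "positive_definite A" and H: "inj ((*v) H)"
  shows "positive_definite (transpose H ** A ** H)"
  unfolding positive_definite_def
proof (intro conjI allI impI)
  show "transpose (transpose H ** A ** H) = transpose H ** A ** H"
    using A by (simp add: positive_definite_def matrix_transpose_mul matrix_mul_assoc)
  fix v :: "real^'n" assume "v \<noteq> 0"
  then have "H *v v \<noteq> 0"
    using injD[OF H, of v 0] by auto
  with A have "(H *v v) \<bullet> (A *v (H *v v)) > 0"
    by (simp add: positive_definite_def)
  also have "(H *v v) \<bullet> (A *v (H *v v)) = (transpose H *v (A *v (H *v v))) \<bullet> v"
    unfolding inner_transpose_matrix by (rule inner_commute)
  finally show "v \<bullet> (transpose H ** A ** H *v v) > 0"
    by (simp only: matrix_vector_mul_assoc matrix_mul_assoc inner_commute)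
qed

text \<open>The matrix \<open>transpose H ** W ** H\<close> is invertible and cancels against its
  inverse. Coherent observations lie in the range of \<open>H\<close>, so the projection will leave
  them unchanged.\<close>

lemma weighted_proj_fixes_range:
  assumes "positive_definite W" "inj ((*v) H)"
  shows "weighted_proj H W ** H = H"
  using matrix_inv_inverse(2)[OF positive_definite_invertible[OF positive_definite_congruence[OF assms]]]
  by (simp add: weighted_proj_def matrix_mul_assoc[symmetric])

text \<open>Pythagoras in the inner product given by \<open>\<Sigma>\<close>: row \<open>i\<close>
  of \<open>P\<close> is orthogonal to its difference from the unit vector, so its norm is at most
  that of the unit vector.\<close>

lemma weighted_proj_reduces_variance:
  fixes \<Sigma> :: "real^'m^'m" and H :: "real^'n^'m"
  assumes S: "positive_definite \<Sigma>" and H: "inj ((*v) H)"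
  defines "P \<equiv> weighted_proj H (matrix_inv \<Sigma>)"
  shows "(P $ i) \<bullet> (\<Sigma> *v (P $ i)) \<le> (mat 1 $ i) \<bullet> (\<Sigma> *v (mat 1 $ i))"
proof -
  define W where "W = matrix_inv \<Sigma>"
  define Gi where "Gi = matrix_inv (transpose H ** W ** H)"
  \<comment> \<open>Common value of \<open>P ** \<Sigma>\<close>,
    \<open>\<Sigma> ** transpose P\<close> and \<open>P ** \<Sigma> ** transpose P\<close>; all the
    mixed terms below reduce to it.\<close>
  define Q where "Q = H ** Gi ** transpose H"
  have W: "positive_definite W"
    unfolding W_def by (rule positive_definite_matrix_inv[OF S])
  have WS: "W ** \<Sigma> = mat 1" "\<Sigma> ** W = mat 1"
    using matrix_inv_inverse[OF positive_definite_invertible[OF S]] by (simp_all add: W_def)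
  have G: "positive_definite (transpose H ** W ** H)"
    by (rule positive_definite_congruence[OF W H])
  have "positive_definite Gi"
    unfolding Gi_def by (rule positive_definite_matrix_inv[OF G])
  then have Qt: "transpose Q = Q"
    by (simp add: Q_def positive_definite_def matrix_transpose_mul matrix_mul_assoc)
  have P: "P = Q ** W"
    by (simp add: P_def weighted_proj_def Q_def Gi_def W_def)
  have Pt: "transpose P = W ** Q"
    using W by (simp add: P matrix_transpose_mul Qt positive_definite_def)
  have PS: "P ** \<Sigma> = Q"
    by (simp only: P matrix_mul_assoc[symmetric] WS matrix_mul_rid)
  have SP: "\<Sigma> ** transpose P = Q"
    by (simp only: Pt matrix_mul_assoc WS matrix_mul_lid)
  have "P ** H = H"
    unfolding P_def using weighted_proj_fixes_range[OF W H] by (simp add: W_def)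
  then have PQ: "P ** Q = Q"
    by (simp add: Q_def matrix_mul_assoc)
  define v where "v = (mat 1 :: real^'m^'m) $ i"
  define u where "u = transpose P *v v"
  have u: "u = P $ i"
    by (simp add: u_def v_def vec_eq_iff vector_matrix_mult_def mat_def if_distrib if_distribR
        cong: if_cong)
  have uu: "u \<bullet> (\<Sigma> *v u) = v \<bullet> (Q *v v)"
    by (simp only: u_def inner_transpose_matrix matrix_vector_mul_assoc PS SP PQ)
  have uv: "u \<bullet> (\<Sigma> *v v) = v \<bullet> (Q *v v)"
    by (simp only: u_def inner_transpose_matrix matrix_vector_mul_assoc PS SP PQ)
  have vu: "v \<bullet> (\<Sigma> *v u) = v \<bullet> (Q *v v)"
    by (simp only: u_def inner_transpose_matrix matrix_vector_mul_assoc PS SP PQ)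
  have "0 \<le> (v - u) \<bullet> (\<Sigma> *v (v - u))"
    using S by (cases "v - u = 0") (auto simp: positive_definite_def less_imp_le)
  also have "\<dots> = v \<bullet> (\<Sigma> *v v) - u \<bullet> (\<Sigma> *v u)"
    by (simp add: matrix_vector_mult_diff_distrib inner_diff_left inner_diff_right uu uv vu)
  finally show ?thesis
    by (simp add: u v_def)
qed

section \<open>The hierarchical matrix, quantile ranks and interval lengths\<close>

lemma hier_matrix_mult_Inl: "(hier_matrix Hsub *v v) $ Inl i = v $ i"
  using arg_cong[OF matrix_vector_mul_lid[of v], of "\<lambda>u. u $ i"]
  by (simp add: matrix_vector_mult_def hier_matrix_def)

text \<open>The top block is the identity, so the \<open>Inl\<close> coordinates recover the
  argument.\<close>

lemma inj_hier_matrix: "inj ((*v) (hier_matrix Hsub))"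
  by (rule injI) (metis hier_matrix_mult_Inl vec_eq_iff)

text \<open>As \<open>N + 1\<close> is an integer, taking the complement to it exchanges floor and
  ceiling, so the two ranks are symmetric in \<open>{0..N + 1}\<close>. The second bound makes the
  subtraction exact and places \<open>lo\<close> at or below \<open>hi\<close>.\<close>

lemma quantile_ranks:
  fixes \<alpha> :: real and N :: nat
  assumes "0 < \<alpha>" "\<alpha> < 1"
  defines "lo \<equiv> nat \<lfloor>(real N + 1) * \<alpha> / 2\<rfloor>" and "hi \<equiv> nat \<lceil>(real N + 1) * (1 - \<alpha> / 2)\<rceil>"
  shows "hi = N + 1 - lo" "2 * lo \<le> N + 1"
proof -
  have "\<lceil>(real N + 1) * (1 - \<alpha> / 2)\<rceil> = int N + 1 - \<lfloor>(real N + 1) * \<alpha> / 2\<rfloor>"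
  proof -
    have "(real N + 1) * (1 - \<alpha> / 2) = of_int (int N + 1) - (real N + 1) * \<alpha> / 2"
      by (simp add: algebra_simps)
    then show ?thesis by linarith
  qed
  moreover have "0 \<le> \<lfloor>(real N + 1) * \<alpha> / 2\<rfloor>" using assms by simp
  ultimately show "hi = N + 1 - lo" by (simp add: lo_def hi_def nat_diff_distrib')
  have "real lo \<le> (real N + 1) * \<alpha> / 2"
    unfolding lo_def using assms by (intro of_nat_floor) simp
  also have "\<dots> \<le> (real N + 1) / 2" using assms by simp
  finally have "real (2 * lo) \<le> real (N + 1)" by simp
  then show "2 * lo \<le> N + 1" by (simp only: of_nat_le_iff)
qed

text \<open>The predicted value shifts both end points equally, so only the calibration scores
  matter. By symmetry of the ranks, the end points are both infinite or both finite.\<close>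

lemma emeasure_conformal_interval:
  fixes \<A> :: "('d::finite, 'm::finite) algorithm" and P :: "real^'m^'m" and \<alpha> :: real and Dtrain Dcalib :: "nat set"
    and xs :: "nat \<Rightarrow> real^'d" and ys :: "nat \<Rightarrow> real^'m" and i :: 'm
  assumes "0 < \<alpha>" "\<alpha> < 1"
  defines "N \<equiv> card Dcalib"
  defines "lo \<equiv> nat \<lfloor>(real N + 1) * \<alpha> / 2\<rfloor>"
    and "s \<equiv> \<lambda>t. (ys t - P *v mu_hat \<A> Dtrain xs ys (xs t)) $ i"
  shows "emeasure lborel (conformal_interval \<A> P \<alpha> Dtrain Dcalib xs ys i x) =
    (if lo = 0 then \<infinity>
     else ennreal (spread Dcalib (lo - 1) (N - lo) s))"
proof -
  define hi where "hi = nat \<lceil>(real N + 1) * (1 - \<alpha> / 2)\<rceil>"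
  note ranks = quantile_ranks[OF assms(1,2), of N, folded lo_def hi_def]
  define \<mu> where "\<mu> = (P *v mu_hat \<A> Dtrain xs ys x) $ i"
  have interval: "conformal_interval \<A> P \<alpha> Dtrain Dcalib xs ys i x =
      {v. ereal \<mu> + order_stat Dcalib s lo \<le> ereal v \<and> ereal v \<le> ereal \<mu> + order_stat Dcalib s hi}"
    by (simp add: conformal_interval_def mu_tilde_def Let_def N_def lo_def hi_def s_def \<mu>_def)
  show ?thesis
  proof (cases "lo = 0")
    case True
    then have "conformal_interval \<A> P \<alpha> Dtrain Dcalib xs ys i x = UNIV"
      unfolding interval using ranks by (simp add: order_stat_def N_def)
    with True show ?thesis by simp
  next
    case False
    let ?o = "\<lambda>j. sort (map s (sorted_list_of_set Dcalib)) ! j"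
    \<comment> \<open>Order statistics count from one and list positions from zero: the upper
      position \<open>hi - 1\<close> is \<open>N - lo\<close>.\<close>
    have stats: "order_stat Dcalib s lo = ereal (?o (lo - 1))"
      "order_stat Dcalib s hi = ereal (?o (N - lo))"
      using False ranks by (auto simp: order_stat_def N_def)
    have "conformal_interval \<A> P \<alpha> Dtrain Dcalib xs ys i x = {\<mu> + ?o (lo - 1)..\<mu> + ?o (N - lo)}"
      unfolding interval stats by auto
    moreover have "?o (lo - 1) \<le> ?o (N - lo)"
      using False ranks by (intro sorted_nth_mono) (auto simp: N_def)
    ultimately show ?thesis using False by (simp add: spread_def)
  qed
qed

section \<open>Comparison of the projected and the plain procedure\<close>

theorem corollary1:
  fixes M :: "'w measure"
    and Hsub :: "real^'n^'k"
    and H :: "real^'n^('n + 'k)"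
    and T :: nat
    and Dtrain Dcalib :: "nat set"
    and x :: "nat \<Rightarrow> 'w \<Rightarrow> real^'d"
    and y :: "nat \<Rightarrow> 'w \<Rightarrow> real^('n + 'k)"
    and \<A> :: "('d, 'n + 'k) algorithm"
    and s_hat :: "nat \<Rightarrow> 'w \<Rightarrow> real^('n + 'k)"
    and \<Sigma> :: "real^('n + 'k)^('n + 'k)"
    and \<alpha> :: real
  assumes "prob_space M"
    and "CARD('n) \<ge> 2"
    and "H = hier_matrix Hsub"
    and "\<And>t. t \<in> {1..T+1} \<Longrightarrow> x t \<in> borel_measurable M"
    and "\<And>t. t \<in> {1..T+1} \<Longrightarrow> y t \<in> borel_measurable M"
    and "\<And>t. t \<in> {1..T+1} \<Longrightarrow> AE \<omega> in M. coherent H (y t \<omega>)"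
    and "Dtrain \<union> Dcalib = {1..T}" and "Dtrain \<inter> Dcalib = {}"
    and "0 < \<alpha>" and "\<alpha> < 1"
    and "s_hat = (\<lambda>t \<omega>. y t \<omega> - mu_hat \<A> Dtrain (\<lambda>u. x u \<omega>) (\<lambda>u. y u \<omega>) (x t \<omega>))"
    and "iid_vars M s_hat (Dcalib \<union> {T+1})"
    and "\<And>t. t \<in> Dcalib \<Longrightarrow> elliptical_distribution (distr M borel (s_hat t))"
    and "\<And>t. t \<in> Dcalib \<Longrightarrow> finite_second_moment M (s_hat t)"
    and "\<And>t. t \<in> Dcalib \<Longrightarrow> covariance_matrix M (s_hat t) = \<Sigma>"
    and "positive_definite \<Sigma>"
  shows "\<forall>i :: 'n + 'k.
    (\<integral>\<^sup>+\<omega>. (emeasure lborel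
        (conformal_interval \<A> (weighted_proj H (matrix_inv \<Sigma>)) \<alpha> Dtrain Dcalib
          (\<lambda>t. x t \<omega>) (\<lambda>t. y t \<omega>) i (x (T+1) \<omega>)))\<^sup>2 \<partial>M)
    \<le> (\<integral>\<^sup>+\<omega>. (emeasure lborel
        (conformal_interval \<A> (mat 1) \<alpha> Dtrain Dcalib
          (\<lambda>t. x t \<omega>) (\<lambda>t. y t \<omega>) i (x (T+1) \<omega>)))\<^sup>2 \<partial>M)"
proof
  fix i :: "'n + 'k"
  interpret prob_space M by fact
  define P where "P = weighted_proj H (matrix_inv \<Sigma>)"
  define N where "N = card Dcalib"
  define lo where "lo = nat \<lfloor>(real N + 1) * \<alpha> / 2\<rfloor>"
  note lengths = emeasure_conformal_interval[OF \<open>0 < \<alpha>\<close> \<open>\<alpha> < 1\<close>, where Dcalib=Dcalib,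
      folded N_def, folded lo_def]
  have S: "positive_definite \<Sigma>" by fact
  have H: "inj ((*v) H)"
    using assms(3) by (simp add: inj_hier_matrix)
  have PH: "P ** H = H"
    unfolding P_def by (rule weighted_proj_fixes_range[OF positive_definite_matrix_inv[OF S] H])
  have "Dcalib \<subseteq> {1..T}"
    using assms(7) by blast
  then have D: "finite Dcalib" "Dcalib \<subseteq> {1..T+1}"
    using finite_subset by fastforce+
  show "(\<integral>\<^sup>+\<omega>. (emeasure lborel
        (conformal_interval \<A> (weighted_proj H (matrix_inv \<Sigma>)) \<alpha> Dtrain Dcalib
          (\<lambda>t. x t \<omega>) (\<lambda>t. y t \<omega>) i (x (T+1) \<omega>)))\<^sup>2 \<partial>M)
    \<le> (\<integral>\<^sup>+\<omega>. (emeasure lborel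
        (conformal_interval \<A> (mat 1) \<alpha> Dtrain Dcalib
          (\<lambda>t. x t \<omega>) (\<lambda>t. y t \<omega>) i (x (T+1) \<omega>)))\<^sup>2 \<partial>M)"
  proof (cases "lo = 0")
    \<comment> \<open>\<open>lo\<close> depends only on \<open>\<alpha>\<close> and
      \<open>N\<close>, so both procedures have intervals of infinite length here.\<close>
    case True
    then show ?thesis by (simp add: lengths)
  next
    case False
    define L where "L s = (ennreal (spread Dcalib (lo - 1) (N - lo) s))\<^sup>2" for s
    have ranks: "lo - 1 \<le> N - lo" "N - lo < card Dcalib"
      using False quantile_ranks(2)[OF \<open>0 < \<alpha>\<close> \<open>\<alpha> < 1\<close>, of N, folded lo_def]
      unfolding N_def[symmetric] by linarith+
    let ?\<mu> = "\<lambda>\<omega>. mu_hat \<A> Dtrain (\<lambda>u. x u \<omega>) (\<lambda>u. y u \<omega>)"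
    have plain: "mat 1 $ i \<bullet> s_hat t \<omega> = (y t \<omega> - mat 1 *v ?\<mu> \<omega> (x t \<omega>)) $ i" for t \<omega>
      using matrix_vector_mul_component[of "mat 1" "s_hat t \<omega>" i] by (simp add: assms(11))
    \<comment> \<open>As \<open>Dcalib\<close> is finite, the exceptional null sets merge into
      one.\<close>
    have "AE \<omega> in M. \<forall>t\<in>Dcalib. coherent H (y t \<omega>)"
      using D assms(6) by (intro AE_finite_allI) auto
    then have coherent: "AE \<omega> in M. L (\<lambda>t. (y t \<omega> - P *v ?\<mu> \<omega> (x t \<omega>)) $ i) =
        L (\<lambda>t. P $ i \<bullet> s_hat t \<omega>)"
    proof eventually_elim
      case (elim \<omega>)
      have "(y t \<omega> - P *v ?\<mu> \<omega> (x t \<omega>)) $ i = P $ i \<bullet> s_hat t \<omega>" if "t \<in> Dcalib" for t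
      proof -
        \<comment> \<open>A coherent observation lies in the range of \<open>H\<close>, which
          \<open>P\<close> fixes. Hence the projected residual is the image under \<open>P\<close>
          of the plain one.\<close>
        have "P *v y t \<omega> = y t \<omega>"
          using elim that unfolding coherent_def by (metis PH matrix_vector_mul_assoc)
        then have "y t \<omega> - P *v ?\<mu> \<omega> (x t \<omega>) = P *v s_hat t \<omega>"
          by (simp add: assms(11) matrix_vector_mult_diff_distrib)
        then show ?thesis
          by (simp add: matrix_vector_mul_component)
      qed
      then have "spread Dcalib (lo - 1) (N - lo) (\<lambda>t. (y t \<omega> - P *v ?\<mu> \<omega> (x t \<omega>)) $ i) =
          spread Dcalib (lo - 1) (N - lo) (\<lambda>t. P $ i \<bullet> s_hat t \<omega>)"
        by (rule spread_cong[OF D(1)])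
      then show ?case
        by (simp only: L_def)
    qed
    have "(\<integral>\<^sup>+\<omega>. L (\<lambda>t. (y t \<omega> - P *v ?\<mu> \<omega> (x t \<omega>)) $ i) \<partial>M) =
        (\<integral>\<^sup>+\<omega>. L (\<lambda>t. P $ i \<bullet> s_hat t \<omega>) \<partial>M)"
      by (rule nn_integral_cong_AE[OF coherent])
    also have "\<dots> \<le> (\<integral>\<^sup>+\<omega>. L (\<lambda>t. mat 1 $ i \<bullet> s_hat t \<omega>) \<partial>M)"
      unfolding L_def
    proof (rule elliptical_spread_le)
      show "indep_vars (\<lambda>_. borel) s_hat Dcalib"
        using assms(12) unfolding iid_vars_def by (blast intro: indep_vars_subset)
      show "distr M borel (s_hat t) = distr M borel (s_hat u)" if "t \<in> Dcalib" "u \<in> Dcalib" for t u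
        using assms(12) that unfolding iid_vars_def by blast
      \<comment> \<open>The diagonal entry \<open>1\<close> makes this row nonzero, so positive
        definiteness gives the plain score a positive variance.\<close>
      have "(mat 1 :: real^('n + 'k)^('n + 'k)) $ i $ i \<noteq> 0"
        by (simp add: mat_def)
      then have "(mat 1 :: real^('n + 'k)^('n + 'k)) $ i \<noteq> 0"
        by (metis zero_index)
      with S show "0 < mat 1 $ i \<bullet> (\<Sigma> *v mat 1 $ i)"
        by (simp add: positive_definite_def)
      show "P $ i \<bullet> (\<Sigma> *v P $ i) \<le> mat 1 $ i \<bullet> (\<Sigma> *v mat 1 $ i)"
        unfolding P_def by (rule weighted_proj_reduces_variance[OF S H])
    qed (fact assms(13) assms(14) assms(15) D(1) ranks)+
    finally show ?thesis
      using False by (simp only: lengths L_def P_def plain if_False)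
  qed
qed

end
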